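(* Let $\gamma,p\in\mathbb N$ with $p\ge\gamma$, and let $\mathcal L$ be a linear partial differential operator of order $\gamma$ with variable coefficients in $\mathcal C^{p-\gamma}$. For any function $u\in\mathcal C^{p+\gamma}$ such that $\mathcal L u=0$ in a neighborhood of $\mathbf x_0$, the Taylor polynomial of order $p$ of $u$ at $\mathbf x_0$ belongs to the quasi-Trefftz space of order $p$: $T_p[u]\in\mathbb{QT}_p$.
   Context: Fix $d\in\mathbb N$ and a point $\mathbf x_0\in\mathbb R^d$; functions are $\mathbb K$-valued with $\mathbb K=\mathbb R$ or $\mathbb C$. $\mathbb N$ is the set of positive integers, $\mathbb N_0=\mathbb N\cup\{0\}$. For $n\in\mathbb N_0$, $\mathcal C^n$ denotes the space of functions with continuous derivatives up to order $n$ in a neighborhood of $\mathbf x_0$. $\mathbb P_p$ is the space of polynomials in $d$ variables of degree at most $p$ over $\mathbb K$. For $\varphi\in\mathcal C^k$, its $k$th Taylor polynomial at $\mathbf x_0$ is $T_k[\varphi]=\sum_{l=0}^k\sum_{|\mathbf i|=l}\frac1{\mathbf i!}\partial^{\mathbf i}\varphi(\mathbf x_0)(\mathbf X-\mathbf x_0)^{\mathbf i}\in\mathbb P_k$. The operator has the form $\mathcal L=\sum_{m=0}^\gamma\sum_{|\mathbf j|=m}c_{\mathbf j}(\mathbf x)\partial_{\mathbf x}^{\mathbf j}$. The quasi-Trefftz space of order $p$ is $\mathbb{QT}_p=\{\Pi\in\mathbb P_p : T_{p-\gamma}[\mathcal L\Pi]=0\}$. *)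

theory Defs
  imports "HOL-Analysis.Analysis"
begin

text \<open>
  Points live in \<open>real ^ 'd\<close>, so the dimension is \<open>CARD('d) \<ge> 1\<close>; a multi-index is a function
  \<open>'d \<Rightarrow> nat\<close>. Scalars are taken from a type of class \<^class>\<open>real_normed_field\<close>, of which
  \<^typ>\<open>real\<close> and \<^typ>\<open>complex\<close> are instances (and, by the Gelfand-Mazur theorem, essentially the
  only ones). Polynomials are represented by the functions they induce, which is faithful because
  the evaluation points range over an infinite field.
\<close>

definition mabs :: "('d::finite \<Rightarrow> nat) \<Rightarrow> nat"
  where "mabs i = (\<Sum>j\<in>UNIV. i j)"

definition mfact :: "('d::finite \<Rightarrow> nat) \<Rightarrow> nat"
  where "mfact i = (\<Prod>j\<in>UNIV. fact (i j))"

definition mpow :: "real ^ 'd \<Rightarrow> ('d::finite \<Rightarrow> nat) \<Rightarrow> 'k::real_normed_field"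
  where "mpow x i = (\<Prod>j\<in>UNIV. of_real (x $ j) ^ i j)"

lemma finite_mabs_le: "finite {i :: 'd::finite \<Rightarrow> nat. mabs i \<le> n}"
proof (rule finite_subset)
  show "{i :: 'd \<Rightarrow> nat. mabs i \<le> n} \<subseteq> PiE UNIV (\<lambda>_. {..n})"
  proof
    fix i :: "'d \<Rightarrow> nat"
    assume "i \<in> {i. mabs i \<le> n}"
    then have "i j \<le> n" for j
      using member_le_sum[of j UNIV i] by (simp add: mabs_def)
    then show "i \<in> PiE UNIV (\<lambda>_. {..n})"
      by (simp add: PiE_UNIV_domain)
  qed
  show "finite (PiE UNIV (\<lambda>_ :: 'd. {..n}))"
    by (simp add: finite_PiE)
qed

lemma finite_mabs_eq: "finite {i :: 'd::finite \<Rightarrow> nat. mabs i = n}"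
  by (rule finite_subset[OF _ finite_mabs_le[of n]]) auto

definition partially_differentiable ::
    "'d::finite \<Rightarrow> (real ^ 'd \<Rightarrow> 'k::real_normed_field) \<Rightarrow> real ^ 'd \<Rightarrow> bool"
  where "partially_differentiable j f x \<longleftrightarrow>
    (\<lambda>t::real. f (x + t *\<^sub>R axis j 1)) differentiable (at 0)"

definition partial_deriv ::
    "'d::finite \<Rightarrow> (real ^ 'd \<Rightarrow> 'k::real_normed_field) \<Rightarrow> real ^ 'd \<Rightarrow> 'k"
  where "partial_deriv j f x = vector_derivative (\<lambda>t::real. f (x + t *\<^sub>R axis j 1)) (at 0)"

text \<open>
  The index type carries no canonical order, so a mixed derivative is taken along an arbitrary but
  fixed enumeration of the coordinates. By the symmetry of mixed derivatives its value at a point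
  does not depend on the enumeration for functions that are \<open>mabs i\<close> times continuously
  differentiable near that point.
\<close>

definition coords :: "'d::finite list"
  where "coords = (SOME js. distinct js \<and> set js = UNIV)"

lemma coords: "distinct (coords :: 'd::finite list)" "set (coords :: 'd list) = UNIV"
proof -
  have "\<exists>js :: 'd list. distinct js \<and> set js = UNIV"
    using finite_distinct_list[of "UNIV :: 'd set"] by auto
  then have "distinct (coords :: 'd list) \<and> set (coords :: 'd list) = UNIV"
    unfolding coords_def by (rule someI_ex)
  then show "distinct (coords :: 'd list)" "set (coords :: 'd list) = UNIV"
    by auto
qed

definition mderiv ::
    "('d::finite \<Rightarrow> nat) \<Rightarrow> (real ^ 'd \<Rightarrow> 'k::real_normed_field) \<Rightarrow> real ^ 'd \<Rightarrow> 'k"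
  where "mderiv i f = foldr (\<lambda>j. partial_deriv j ^^ i j) coords f"

primrec Cn_on ::
    "nat \<Rightarrow> (real ^ 'd::finite) set \<Rightarrow> (real ^ 'd \<Rightarrow> 'k::real_normed_field) \<Rightarrow> bool"
  where
    "Cn_on 0 U f \<longleftrightarrow> continuous_on U f"
  | "Cn_on (Suc n) U f \<longleftrightarrow> continuous_on U f \<and>
      (\<forall>j. (\<forall>x\<in>U. partially_differentiable j f x) \<and> Cn_on n U (partial_deriv j f))"

definition Cn_near ::
    "nat \<Rightarrow> real ^ 'd::finite \<Rightarrow> (real ^ 'd \<Rightarrow> 'k::real_normed_field) set"
  where "Cn_near n x0 = {f. \<exists>U. open U \<and> x0 \<in> U \<and> Cn_on n U f}"

definition poly_space :: "nat \<Rightarrow> (real ^ 'd::finite \<Rightarrow> 'k::real_normed_field) set"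
  where "poly_space p = {P. \<exists>a. P = (\<lambda>x. \<Sum>i | mabs i \<le> p. a i * mpow x i)}"

definition taylor ::
    "nat \<Rightarrow> real ^ 'd::finite \<Rightarrow> (real ^ 'd \<Rightarrow> 'k::real_normed_field) \<Rightarrow> real ^ 'd \<Rightarrow> 'k"
  where "taylor k x0 f = (\<lambda>x. \<Sum>l\<le>k. \<Sum>i | mabs i = l.
    1 / of_nat (mfact i) * mderiv i f x0 * mpow (x - x0) i)"

definition diff_op ::
    "nat \<Rightarrow> (('d::finite \<Rightarrow> nat) \<Rightarrow> real ^ 'd \<Rightarrow> 'k::real_normed_field) \<Rightarrow>
      (real ^ 'd \<Rightarrow> 'k) \<Rightarrow> real ^ 'd \<Rightarrow> 'k"
  where "diff_op \<gamma> c f = (\<lambda>x. \<Sum>m\<le>\<gamma>. \<Sum>j | mabs j = m. c j x * mderiv j f x)"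

definition quasi_Trefftz ::
    "nat \<Rightarrow> (('d::finite \<Rightarrow> nat) \<Rightarrow> real ^ 'd \<Rightarrow> 'k::real_normed_field) \<Rightarrow>
      real ^ 'd \<Rightarrow> nat \<Rightarrow> (real ^ 'd \<Rightarrow> 'k) set"
  where "quasi_Trefftz \<gamma> c x0 p =
    {P \<in> poly_space p. taylor (p - \<gamma>) x0 (diff_op \<gamma> c P) = (\<lambda>x. 0)}"

end

theory Submission
  imports Defs
begin

text \<open>
  Let \<open>w = T\<^sub>p[u] - u\<close> be the negative Taylor remainder. All partial derivatives of \<open>w\<close> of order up
  to \<open>p\<close> vanish at \<open>x0\<close>. Every summand \<open>c j * D\<^sup>j w\<close> of \<open>L w\<close> loses at most \<open>\<gamma>\<close> orders
  through the derivative \<open>D\<^sup>j\<close> and none through the factor \<open>c j\<close>, because the functions that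
  vanish to order \<open>p - \<gamma>\<close> form an ideal among the \<open>p - \<gamma>\<close> times
  continuously differentiable functions. Hence \<open>L w\<close> vanishes
  to order \<open>p - \<gamma>\<close> at \<open>x0\<close>. Near \<open>x0\<close> one has \<open>L T\<^sub>p[u] = L u + L w = L w\<close>, so the Taylor
  polynomial of \<open>L T\<^sub>p[u]\<close> of order \<open>p - \<gamma>\<close> is zero.

  The vanishing of the remainder is \<open>taylor_remainder_vanishes_to_order\<close>. It is proved by induction
  on the order from the identity \<open>\<partial>\<^sub>j T\<^sub>n\<^sub>+\<^sub>1[f] = T\<^sub>n[\<partial>\<^sub>j f]\<close> (\<open>has_partial_deriv_taylor\<close>), which
  avoids computing the derivatives of the Taylor polynomial one multi-index at a time. That identity
  compares \<open>D\<^sup>i \<partial>\<^sub>j f\<close> with the derivative for the multi-index in which \<open>i j\<close> is raised by one. The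
  latter is taken along a fixed enumeration of the coordinates, so the comparison needs the symmetry
  of mixed derivatives (\<open>partial_deriv_commute\<close>, \<open>partial_derivs_perm\<close>). The order loss is
  \<open>diff_op_vanishes_to_order\<close>, which rests on the product lemma \<open>vanishes_to_order_mult\<close>.

  Membership of \<open>T\<^sub>p[u]\<close> in the polynomial space is a separate matter: a monomial in \<open>X - x0\<close> has to
  be expanded in powers of \<open>X\<close> without raising the degree (\<open>shifted_mpow_mem_poly_space\<close>).
\<close>

section \<open>Partial derivatives of scalar functions\<close>

text \<open>
  Combining existence and value in one relation gives sum and product rules that can be chained
  without discharging differentiability separately at each step.
\<close>

definition has_partial_deriv ::
    "'d::finite \<Rightarrow> (real ^ 'd \<Rightarrow> 'k::real_normed_field) \<Rightarrow> 'k \<Rightarrow> real ^ 'd \<Rightarrow> bool"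
  where "has_partial_deriv j f D x \<longleftrightarrow>
    ((\<lambda>t::real. f (x + t *\<^sub>R axis j 1)) has_vector_derivative D) (at 0)"

lemma has_partial_deriv_imp:
  assumes "has_partial_deriv j f D x"
  shows "partially_differentiable j f x" "partial_deriv j f x = D"
  using assms unfolding has_partial_deriv_def partially_differentiable_def partial_deriv_def
  by (auto intro: differentiableI_vector vector_derivative_at)

lemma partially_differentiable_has_partial_deriv:
  "partially_differentiable j f x \<Longrightarrow> has_partial_deriv j f (partial_deriv j f x) x"
  unfolding has_partial_deriv_def partially_differentiable_def partial_deriv_def
  by (simp add: vector_derivative_works)

lemma has_partial_deriv_const: "has_partial_deriv j (\<lambda>x. a) 0 x"
  unfolding has_partial_deriv_def by simp

lemma has_partial_deriv_add:
  "has_partial_deriv j f D x \<Longrightarrow> has_partial_deriv j g E x \<Longrightarrow>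
    has_partial_deriv j (\<lambda>x. f x + g x) (D + E) x"
  unfolding has_partial_deriv_def by (rule has_vector_derivative_add)

lemma has_partial_deriv_diff:
  "has_partial_deriv j f D x \<Longrightarrow> has_partial_deriv j g E x \<Longrightarrow>
    has_partial_deriv j (\<lambda>x. f x - g x) (D - E) x"
  unfolding has_partial_deriv_def by (rule has_vector_derivative_diff)

lemma has_partial_deriv_mult:
  "has_partial_deriv j f D x \<Longrightarrow> has_partial_deriv j g E x \<Longrightarrow>
    has_partial_deriv j (\<lambda>x. f x * g x) (D * g x + f x * E) x"
  unfolding has_partial_deriv_def
  by (drule (1) has_vector_derivative_mult) (simp add: add.commute)

lemma has_partial_deriv_sum:
  "(\<And>i. i \<in> I \<Longrightarrow> has_partial_deriv j (f i) (D i) x) \<Longrightarrow>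
    has_partial_deriv j (\<lambda>x. \<Sum>i\<in>I. f i x) (\<Sum>i\<in>I. D i) x"
  unfolding has_partial_deriv_def by (rule has_vector_derivative_sum)

lemma has_partial_deriv_cong_on:
  assumes "open U" "x \<in> U" "\<And>y. y \<in> U \<Longrightarrow> f y = g y" "has_partial_deriv j f D x"
  shows "has_partial_deriv j g D x"
proof -
  have "open ((\<lambda>t::real. x + t *\<^sub>R axis j 1) -` U)"
    by (intro open_vimage assms continuous_intros)
  then have "\<forall>\<^sub>F t in nhds (0::real). x + t *\<^sub>R axis j 1 \<in> U"
    using assms(2) by (intro eventually_nhds[THEN iffD2] exI[of _ "(\<lambda>t::real. x + t *\<^sub>R axis j 1) -` U"]) auto
  then have "\<forall>\<^sub>F t in nhds (0::real). f (x + t *\<^sub>R axis j 1) = g (x + t *\<^sub>R axis j 1)"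
    by (rule eventually_mono) (rule assms(3))
  then show ?thesis
    using assms unfolding has_partial_deriv_def
    by (subst has_vector_derivative_cong_ev[where g = "\<lambda>t. f (x + t *\<^sub>R axis j 1)"])
       (auto elim!: eventually_mono)
qed

text \<open>
  Partial derivatives are defined by derivatives at parameter \<open>0\<close> only; translating the parameter
  makes the mean value inequality applicable on a whole segment.
\<close>

lemma has_partial_deriv_along_line:
  assumes "partially_differentiable j f (y + s *\<^sub>R axis j 1)"
  shows "((\<lambda>s. f (y + s *\<^sub>R axis j 1)) has_vector_derivative
    partial_deriv j f (y + s *\<^sub>R axis j 1)) (at s)"
proof -
  have "((\<lambda>t. f (y + s *\<^sub>R axis j 1 + t *\<^sub>R axis j 1)) has_vector_derivative
    partial_deriv j f (y + s *\<^sub>R axis j 1)) (at (s - s))"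
    using partially_differentiable_has_partial_deriv[OF assms] by (simp add: has_partial_deriv_def)
  moreover have "((\<lambda>r::real. r - s) has_vector_derivative 1) (at s)"
    by (auto intro!: derivative_eq_intros simp: has_vector_derivative_def)
  ultimately have "(((\<lambda>t. f (y + s *\<^sub>R axis j 1 + t *\<^sub>R axis j 1)) \<circ> (\<lambda>r. r - s))
      has_vector_derivative 1 *\<^sub>R partial_deriv j f (y + s *\<^sub>R axis j 1)) (at s)"
    by (intro vector_diff_chain_at)
  then show ?thesis
    by (simp add: o_def algebra_simps)
qed

section \<open>Symmetry of second partial derivatives\<close>

text \<open>
  The mean value inequality is used twice: first in \<open>s\<close> for \<open>F2 s t - s *\<^sub>R A\<close>, then in \<open>t\<close> for
  \<open>F h t - F 0 t - t *\<^sub>R h *\<^sub>R A\<close>. This inequality holds for values in any normed space, so it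
  covers all scalar fields at once.
\<close>

lemma second_difference_bound:
  fixes F :: "real \<Rightarrow> real \<Rightarrow> 'k::real_normed_vector"
  assumes h: "h \<ge> 0"
    and F2: "\<And>s t. s \<in> {0..h} \<Longrightarrow> t \<in> {0..h} \<Longrightarrow> ((\<lambda>t. F s t) has_vector_derivative F2 s t) (at t)"
    and F12: "\<And>s t. s \<in> {0..h} \<Longrightarrow> t \<in> {0..h} \<Longrightarrow> ((\<lambda>s. F2 s t) has_vector_derivative F12 s t) (at s)"
    and bound: "\<And>s t. s \<in> {0..h} \<Longrightarrow> t \<in> {0..h} \<Longrightarrow> norm (F12 s t - A) \<le> e"
  shows "norm (F h h - F 0 h - F h 0 + F 0 0 - (h * h) *\<^sub>R A) \<le> h * h * e"
proof -
  have *: "norm (g h - g 0) \<le> h * B"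
    if "\<And>t. t \<in> {0..h} \<Longrightarrow> (g has_vector_derivative g' t) (at t)"
      and "\<And>t. t \<in> {0..h} \<Longrightarrow> norm (g' t) \<le> B"
    for g :: "real \<Rightarrow> 'k" and g' B
  proof -
    have "norm (g h - g 0) \<le> B * norm (h - 0)"
    proof (rule differentiable_bound[where S = "{0..h}" and f' = "\<lambda>t r. r *\<^sub>R g' t"])
      show "onorm (\<lambda>r. r *\<^sub>R g' t) \<le> B" if "t \<in> {0..h}" for t
        using \<open>\<And>t. t \<in> {0..h} \<Longrightarrow> norm (g' t) \<le> B\<close>[OF that]
        by (simp add: onorm_scaleR_left onorm_id)
    qed (use h that(1) in \<open>auto simp: has_vector_derivative_def intro: has_derivative_at_withinI\<close>)
    then show ?thesis using h by (simp add: mult.commute)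
  qed
  have inner: "norm (F2 h t - F2 0 t - h *\<^sub>R A) \<le> h * e" if "t \<in> {0..h}" for t
  proof -
    have "norm ((F2 h t - h *\<^sub>R A) - (F2 0 t - 0 *\<^sub>R A)) \<le> h * e"
      by (rule *[where g' = "\<lambda>s. F12 s t - A"])
         (auto intro!: derivative_eq_intros F12 bound that)
    then show ?thesis by (simp add: algebra_simps)
  qed
  have "norm ((F h h - F 0 h - h *\<^sub>R h *\<^sub>R A) - (F h 0 - F 0 0 - 0 *\<^sub>R h *\<^sub>R A)) \<le> h * (h * e)"
    by (rule *[where g' = "\<lambda>t. F2 h t - F2 0 t - h *\<^sub>R A"])
       (use h in \<open>auto intro!: derivative_eq_intros F2 inner\<close>)
  then show ?thesis by (simp add: algebra_simps)
qed

text \<open>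
  Schwarz's theorem. The second difference of \<open>f\<close> over a small square with side \<open>h\<close> is symmetric in
  the two directions, and after division by \<open>h * h\<close> it is close to either mixed derivative at \<open>x\<close>.
\<close>

lemma partial_deriv_commute:
  assumes U: "open U" "x \<in> U" and f: "Cn_on 2 U f"
  shows "partial_deriv j (partial_deriv k f) x = partial_deriv k (partial_deriv j f) x"
proof -
  let ?p = "\<lambda>j k s t. x + s *\<^sub>R axis j 1 + t *\<^sub>R axis k (1::real)"
  let ?A = "\<lambda>j k. partial_deriv j (partial_deriv k f)"
  have d: "partially_differentiable j f y" "partially_differentiable j (partial_deriv k f) y"
    and c: "continuous_on U (?A j k)" if "y \<in> U" for j k y
    using f that by (auto simp: numeral_2_eq_2)
  have "norm (?A j k x - ?A k j x) \<le> e" if "e > 0" for e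
  proof -
    have near: "\<exists>r>0. \<forall>s t. \<bar>s\<bar> < r \<and> \<bar>t\<bar> < r \<longrightarrow>
        ?p j k s t \<in> U \<and> norm (?A j k (?p j k s t) - ?A j k x) \<le> e / 2" for j k
    proof -
      obtain r where r: "r > 0" "ball x r \<subseteq> U"
        "\<And>y. y \<in> ball x r \<Longrightarrow> norm (?A j k y - ?A j k x) < e / 2"
      proof -
        have "continuous (at x) (?A j k)"
          using c[OF U(2)] U by (simp add: continuous_on_eq_continuous_at)
        then obtain a where a: "a > 0" "\<And>y. dist y x < a \<Longrightarrow> dist (?A j k y) (?A j k x) < e / 2"
          using \<open>e > 0\<close> unfolding continuous_at_eps_delta by (metis half_gt_zero)
        obtain b where b: "b > 0" "ball x b \<subseteq> U"
          using U openE by blast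
        show ?thesis
          by (rule that[of "min a b"]) (use a b in \<open>auto simp: dist_norm norm_minus_commute subset_iff\<close>)
      qed
      \<comment> \<open>Halving the radius absorbs the two coordinate displacements.\<close>
      have "?p j k s t \<in> ball x r" if "\<bar>s\<bar> < r / 2" "\<bar>t\<bar> < r / 2" for s t
      proof -
        have "norm (s *\<^sub>R axis j (1::real) + t *\<^sub>R axis k 1) \<le> \<bar>s\<bar> + \<bar>t\<bar>"
          using norm_triangle_ineq[of "s *\<^sub>R axis j (1::real)" "t *\<^sub>R axis k 1"]
          by (simp add: norm_axis_1)
        moreover have "dist x (?p j k s t) = norm (s *\<^sub>R axis j (1::real) + t *\<^sub>R axis k 1)"
          by (metis add.assoc dist_add_cancel dist_0_norm add.right_neutral)
        ultimately show ?thesis using that by auto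
      qed
      then show ?thesis
        using r by (intro exI[of _ "r / 2"]) (auto intro: less_imp_le)
    qed
    obtain r1 where r1: "r1 > 0"
      "\<And>s t. \<bar>s\<bar> < r1 \<Longrightarrow> \<bar>t\<bar> < r1 \<Longrightarrow>
        ?p j k s t \<in> U \<and> norm (?A j k (?p j k s t) - ?A j k x) \<le> e / 2"
      using near[of j k] by blast
    obtain r2 where r2: "r2 > 0"
      "\<And>s t. \<bar>s\<bar> < r2 \<Longrightarrow> \<bar>t\<bar> < r2 \<Longrightarrow>
        ?p k j s t \<in> U \<and> norm (?A k j (?p k j s t) - ?A k j x) \<le> e / 2"
      using near[of k j] by blast
    define h where "h = min r1 r2 / 2"
    have h: "h > 0" "h < r1" "h < r2"
      using r1(1) r2(1) by (auto simp: h_def)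
    have bound: "norm (f (?p j k h h) - f (?p j k 0 h) - f (?p j k h 0) + f (?p j k 0 0)
        - (h * h) *\<^sub>R ?A j k x) \<le> h * h * (e / 2)"
      if "\<And>s t. s \<in> {0..h} \<Longrightarrow> t \<in> {0..h} \<Longrightarrow>
        ?p j k s t \<in> U \<and> norm (?A j k (?p j k s t) - ?A j k x) \<le> e / 2" for j k
    proof (rule second_difference_bound[where ?F2.0 = "\<lambda>s t. partial_deriv k f (?p j k s t)"
          and ?F12.0 = "\<lambda>s t. ?A j k (?p j k s t)"])
      fix s t assume st: "s \<in> {0..h}" "t \<in> {0..h}"
      show "((\<lambda>t. f (?p j k s t)) has_vector_derivative partial_deriv k f (?p j k s t)) (at t)"
        using that[OF st] by (intro has_partial_deriv_along_line d) auto
      have swap: "?p j k s t = x + t *\<^sub>R axis k 1 + s *\<^sub>R axis j 1" for s t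
        by (simp add: algebra_simps)
      show "((\<lambda>s. partial_deriv k f (?p j k s t)) has_vector_derivative ?A j k (?p j k s t)) (at s)"
        unfolding swap using that[OF st]
        by (intro has_partial_deriv_along_line d) (auto simp: swap)
    qed (use h that in auto)
    have 1: "norm (f (?p j k h h) - f (?p j k 0 h) - f (?p j k h 0) + f (?p j k 0 0)
        - (h * h) *\<^sub>R ?A j k x) \<le> h * h * (e / 2)"
      by (rule bound) (use r1 h in auto)
    have 2: "norm (f (?p k j h h) - f (?p k j 0 h) - f (?p k j h 0) + f (?p k j 0 0)
        - (h * h) *\<^sub>R ?A k j x) \<le> h * h * (e / 2)"
      by (rule bound) (use r2 h in auto)
    let ?\<Delta> = "f (?p j k h h) - f (?p j k 0 h) - f (?p j k h 0) + f (?p j k 0 0)"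
    have eq: "f (?p k j h h) - f (?p k j 0 h) - f (?p k j h 0) + f (?p k j 0 0) = ?\<Delta>"
      by (simp add: algebra_simps)
    have "norm ((h * h) *\<^sub>R (?A j k x - ?A k j x)) =
        norm ((?\<Delta> - (h * h) *\<^sub>R ?A k j x) - (?\<Delta> - (h * h) *\<^sub>R ?A j k x))"
      by (simp add: algebra_simps)
    also have "\<dots> \<le> norm (?\<Delta> - (h * h) *\<^sub>R ?A k j x) + norm (?\<Delta> - (h * h) *\<^sub>R ?A j k x)"
      by (rule norm_triangle_ineq4)
    also have "\<dots> \<le> h * h * (e / 2) + h * h * (e / 2)"
      using 1 2 unfolding eq by (rule add_mono[rotated])
    also have "\<dots> = h * h * e" by simp
    finally show ?thesis using h by simp
  qed
  then have "norm (?A j k x - ?A k j x) \<le> 0"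
    by (rule field_le_epsilon[of _ 0, simplified]) 
  then show ?thesis by simp
qed

section \<open>Calculus of \<open>C\<^sup>n\<close> functions\<close>

lemma Cn_on_has_partial_deriv:
  "Cn_on (Suc n) U f \<Longrightarrow> x \<in> U \<Longrightarrow> has_partial_deriv j f (partial_deriv j f x) x"
  by (auto intro: partially_differentiable_has_partial_deriv)

lemma Cn_on_SucI:
  assumes "continuous_on U f"
    and "\<And>j x. x \<in> U \<Longrightarrow> has_partial_deriv j f (f' j x) x"
    and "\<And>j. Cn_on n U (partial_deriv j f)"
  shows "Cn_on (Suc n) U f"
  using assms by (auto dest: has_partial_deriv_imp)

lemma Cn_on_imp_continuous_on: "Cn_on n U f \<Longrightarrow> continuous_on U f"
  by (cases n) auto

text \<open>
  Openness of \<open>U\<close> is what makes this true: the values of a partial derivative on \<open>U\<close> are then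
  determined by the values of the function on \<open>U\<close>, so the induction can pass to the derivatives.
\<close>

lemma Cn_on_cong:
  assumes "open U" "\<And>x. x \<in> U \<Longrightarrow> f x = g x" "Cn_on n U f"
  shows "Cn_on n U g"
  using assms(2,3)
proof (induction n arbitrary: f g)
  case 0
  then show ?case by (auto cong: continuous_on_cong)
next
  case (Suc n)
  have g: "has_partial_deriv j g (partial_deriv j f x) x" if "x \<in> U" for j x
    using assms(1) that Suc.prems(1) Cn_on_has_partial_deriv[OF Suc.prems(2) that]
    by (rule has_partial_deriv_cong_on)
  show ?case
  proof (rule Cn_on_SucI)
    show "continuous_on U g"
      using Suc.prems by (auto cong: continuous_on_cong)
    show "Cn_on n U (partial_deriv j g)" for j
      by (rule Suc.IH[of "partial_deriv j f"])
         (use Suc.prems has_partial_deriv_imp(2)[OF g] in auto)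
  qed (rule g)
qed

text \<open>
  A formula for the partial derivatives has to hold only on \<open>U\<close>, where the derivative rules supply
  it; elsewhere nothing is known about \<open>f\<close>.
\<close>

lemma Cn_on_SucI_on_open:
  assumes "open U" "continuous_on U f"
    and "\<And>j x. x \<in> U \<Longrightarrow> has_partial_deriv j f (f' j x) x"
    and "\<And>j. Cn_on n U (f' j)"
  shows "Cn_on (Suc n) U f"
proof (rule Cn_on_SucI[OF assms(2,3)])
  show "Cn_on n U (partial_deriv j f)" for j
    by (rule Cn_on_cong[OF assms(1) _ assms(4)[of j]])
       (metis assms(3) has_partial_deriv_imp(2))
qed

lemma Cn_on_Suc_imp: "Cn_on (Suc n) U f \<Longrightarrow> Cn_on n U f"
  by (induction n arbitrary: f) auto

lemma Cn_on_mono: "m \<le> n \<Longrightarrow> Cn_on n U f \<Longrightarrow> Cn_on m U f"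
  by (induction n rule: dec_induct) (auto dest: Cn_on_Suc_imp simp del: Cn_on.simps)

lemma Cn_on_subset: "Cn_on n U f \<Longrightarrow> V \<subseteq> U \<Longrightarrow> Cn_on n V f"
  by (induction n arbitrary: f) (auto intro: continuous_on_subset)

lemma Cn_on_const: "open U \<Longrightarrow> Cn_on n U (\<lambda>x. a)"
proof (induction n arbitrary: a)
  case (Suc n)
  show ?case
    by (rule Cn_on_SucI_on_open[where f' = "\<lambda>_ _. 0"])
       (use Suc in \<open>auto intro: has_partial_deriv_const\<close>)
qed simp

lemma Cn_on_add:
  "open U \<Longrightarrow> Cn_on n U f \<Longrightarrow> Cn_on n U g \<Longrightarrow> Cn_on n U (\<lambda>x. f x + g x)"
proof (induction n arbitrary: f g)
  case (Suc n)
  show ?case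
    by (rule Cn_on_SucI_on_open[where f' = "\<lambda>j x. partial_deriv j f x + partial_deriv j g x"])
       (use Suc in \<open>auto intro!: has_partial_deriv_add continuous_intros
          intro: partially_differentiable_has_partial_deriv\<close>)
qed (auto intro: continuous_intros)

lemma Cn_on_mult:
  "open U \<Longrightarrow> Cn_on n U f \<Longrightarrow> Cn_on n U g \<Longrightarrow> Cn_on n U (\<lambda>x. f x * g x)"
proof (induction n arbitrary: f g)
  case (Suc n)
  have "Cn_on n U f" "Cn_on n U g"
    using Suc.prems Cn_on_Suc_imp by blast+
  then show ?case
    by (intro Cn_on_SucI_on_open[where f' = "\<lambda>j x. partial_deriv j f x * g x + f x * partial_deriv j g x"])
       (use Suc in \<open>auto intro!: has_partial_deriv_mult Cn_on_add continuous_intros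
          intro: partially_differentiable_has_partial_deriv\<close>)
qed (auto intro: continuous_intros)

lemma Cn_on_diff:
  assumes "open U" "Cn_on n U f" "Cn_on n U g"
  shows "Cn_on n U (\<lambda>x. f x - g x)"
  using Cn_on_add[OF assms(1,2) Cn_on_mult[OF assms(1) Cn_on_const[OF assms(1), of _ "-1"] assms(3)]]
  by simp

lemma Cn_on_sum:
  assumes "open U" "\<And>i. i \<in> I \<Longrightarrow> Cn_on n U (f i)"
  shows "Cn_on n U (\<lambda>x. \<Sum>i\<in>I. f i x)"
  using assms(2)
  by (induction I rule: infinite_finite_induct) (auto intro: Cn_on_const Cn_on_add assms(1))

section \<open>Iterated partial derivatives\<close>

text \<open>
  Derivatives along a list of directions generalize \<^const>\<open>mderiv\<close>: they admit arbitrary orders of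
  differentiation, and facts about them follow by list induction.
\<close>

abbreviation partial_derivs ::
    "'d::finite list \<Rightarrow> (real ^ 'd \<Rightarrow> 'k::real_normed_field) \<Rightarrow> real ^ 'd \<Rightarrow> 'k"
  where "partial_derivs js f \<equiv> foldr partial_deriv js f"

definition directions :: "('d::finite \<Rightarrow> nat) \<Rightarrow> 'd list"
  where "directions i = concat (map (\<lambda>j. replicate (i j) j) coords)"

lemma mderiv_eq_partial_derivs: "mderiv i f = partial_derivs (directions i) f"
proof -
  have "foldr partial_deriv (replicate n j) g = (partial_deriv j ^^ n) g"
    for n j and g :: "real ^ 'a \<Rightarrow> 'b"
    by (induction n) auto
  then have "foldr (\<lambda>j. partial_deriv j ^^ i j) js f =
      partial_derivs (concat (map (\<lambda>j. replicate (i j) j) js)) f" for js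
    by (induction js) auto
  then show ?thesis by (simp add: mderiv_def directions_def)
qed

lemma length_directions: "length (directions i) = mabs i"
  using coords[where 'd = 'a]
  by (simp add: directions_def mabs_def length_concat o_def sum_list_distinct_conv_sum_set)

lemma count_directions: "count (mset (directions i)) j = i j"
proof -
  have "count (mset (concat (map (\<lambda>j. replicate (i j) j) js))) j = (if j \<in> set js then i j else 0)"
    if "distinct js" for js
    using that by (induction js) auto
  then show ?thesis
    using coords[where 'd = 'a] by (simp add: directions_def)
qed

lemma Cn_on_partial_derivs:
  "Cn_on n U f \<Longrightarrow> length js + m \<le> n \<Longrightarrow> Cn_on m U (partial_derivs js f)"
proof (induction js arbitrary: m)
  case Nil
  then show ?case using Cn_on_mono by auto
next
  case (Cons j js)
  then have "Cn_on (Suc m) U (partial_derivs js f)"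
    by (simp del: Cn_on.simps)
  then show ?case by simp
qed

lemma partial_deriv_cong_on:
  assumes "open U" "x \<in> U" "\<And>y. y \<in> U \<Longrightarrow> f y = g y" 
  shows "partial_deriv j f x = partial_deriv j g x"
proof -
  have "has_partial_deriv j f D x \<longleftrightarrow> has_partial_deriv j g D x" for D
    using has_partial_deriv_cong_on[OF assms(1,2)] assms(3) by metis
  then show ?thesis
    by (simp add: partial_deriv_def vector_derivative_def has_partial_deriv_def)
qed

lemma partial_derivs_diff:
  assumes "open U" "Cn_on n U f" "Cn_on n U g" "length js \<le> n" "x \<in> U"
  shows "partial_derivs js (\<lambda>x. f x - g x) x = partial_derivs js f x - partial_derivs js g x"
  using assms(4,5)
proof (induction js arbitrary: x)
  case (Cons j js)
  have d: "has_partial_deriv j (partial_derivs js h) (partial_deriv j (partial_derivs js h) x) x"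
    if "Cn_on n U h" for h
    using Cn_on_partial_derivs[OF that, of js 1] Cons.prems
    by (intro Cn_on_has_partial_deriv[of 0 U]) auto
  have "partial_deriv j (partial_derivs js (\<lambda>x. f x - g x)) x =
      partial_deriv j (\<lambda>x. partial_derivs js f x - partial_derivs js g x) x"
    by (rule partial_deriv_cong_on[OF assms(1) Cons.prems(2)]) (use Cons in auto)
  also have "\<dots> = partial_deriv j (partial_derivs js f) x - partial_deriv j (partial_derivs js g) x"
    using assms by (intro has_partial_deriv_imp(2) has_partial_deriv_diff d)
  finally show ?case by simp
qed simp

lemma partial_derivs_move:
  assumes "open U" "Cn_on n U f" "length js + length ks + 1 \<le> n" "x \<in> U"
  shows "partial_derivs (j # js @ ks) f x = partial_derivs (js @ j # ks) f x"
  using assms(3,4)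
proof (induction js arbitrary: x)
  case (Cons i js)
  have "Cn_on 2 U (partial_derivs (js @ ks) f)"
    by (rule Cn_on_partial_derivs[OF assms(2)]) (use Cons in auto)
  then have "partial_derivs (j # (i # js) @ ks) f x = partial_derivs (i # j # js @ ks) f x"
    using partial_deriv_commute[OF assms(1) Cons.prems(2)] by simp
  also have "\<dots> = partial_derivs (i # js @ j # ks) f x"
    unfolding foldr_Cons o_def[of "partial_deriv i"]
    by (rule partial_deriv_cong_on[OF assms(1) Cons.prems(2)]) (use Cons in simp)
  finally show ?case by simp
qed simp

text \<open>
  The first direction of one list is brought to the front of the other by \<open>partial_derivs_move\<close>,
  which leaves shorter lists to compare.
\<close>

lemma partial_derivs_perm:
  assumes "open U" "Cn_on n U f" "mset js = mset ks" "length js \<le> n" "x \<in> U"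
  shows "partial_derivs js f x = partial_derivs ks f x"
  using assms(3-)
proof (induction js arbitrary: ks x)
  case (Cons j js)
  then have "j \<in> set ks" by (metis list.set_intros(1) mset_eq_setD)
  then obtain k1 k2 where ks: "ks = k1 @ j # k2" by (meson split_list)
  then have *: "mset js = mset (k1 @ k2)" using Cons.prems by simp
  have "partial_derivs (j # js) f x = partial_derivs (j # k1 @ k2) f x"
    unfolding foldr_Cons o_def[of "partial_deriv j"]
    by (rule partial_deriv_cong_on[OF assms(1) Cons.prems(3)])
       (use Cons.IH[OF *] Cons.prems in auto)
  also have "\<dots> = partial_derivs ks f x"
    unfolding ks
    by (rule partial_derivs_move[OF assms(1,2) _ Cons.prems(3)])
       (use Cons.prems mset_eq_length[OF *] in auto)
  finally show ?case .
qed simp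

text \<open>
  Differentiating first in direction \<open>j\<close> appends \<open>j\<close> to the list of directions of \<open>i\<close>, and this is a
  permutation of the list for the raised multi-index.
\<close>

lemma mderiv_partial_deriv:
  assumes "open U" "Cn_on n U f" "mabs i < n" "x \<in> U"
  shows "mderiv i (partial_deriv j f) x = mderiv (i(j := Suc (i j))) f x"
proof -
  have "partial_derivs (directions i @ [j]) f x = partial_derivs (directions (i(j := Suc (i j)))) f x"
    by (rule partial_derivs_perm[OF assms(1,2) _ _ assms(4)])
       (use assms(3) in \<open>auto simp: length_directions multiset_eq_iff count_directions\<close>)
  then show ?thesis by (simp add: mderiv_eq_partial_derivs)
qed

section \<open>Monomials and Taylor polynomials\<close>

text \<open>
  If \<open>i j = 0\<close>, the truncated exponent \<open>i j - 1\<close> is harmless because of the factor \<open>of_nat (i j)\<close>.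
\<close>

lemma has_partial_deriv_mpow:
  "has_partial_deriv j (\<lambda>x. mpow (x - x0) i :: 'k::real_normed_field)
    (of_nat (i j) * mpow (x - x0) (i(j := i j - 1))) x"
proof -
  define R where "R = (\<Prod>k\<in>UNIV - {j}. of_real ((x - x0) $ k) ^ i k :: 'k)"
  have split: "mpow y m = of_real (y $ j) ^ m j * (\<Prod>k\<in>UNIV - {j}. of_real (y $ k) ^ m k :: 'k)"
    for y :: "real ^ 'a" and m
    unfolding mpow_def by (rule prod.remove) auto
  have "mpow (x + t *\<^sub>R axis j 1 - x0) i = of_real ((x - x0) $ j + t) ^ i j * R" for t
    unfolding split R_def by (auto simp: axis_def algebra_simps intro!: prod.cong)
  moreover have "mpow (x - x0) (i(j := i j - 1)) = of_real ((x - x0) $ j) ^ (i j - 1) * R"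
    unfolding split R_def by (auto intro!: prod.cong)
  moreover have "((\<lambda>t. of_real ((x - x0) $ j + t) ^ i j * R) has_vector_derivative
      of_nat (i j) * (of_real ((x - x0) $ j) ^ (i j - 1) * R)) (at 0)"
  proof -
    have "((\<lambda>z. (of_real ((x - x0) $ j) + z) ^ i j * R) has_field_derivative
      of_nat (i j) * (of_real ((x - x0) $ j) ^ (i j - 1) * R)) (at (of_real 0))"
      by (auto intro!: derivative_eq_intros simp: algebra_simps)
    then have "((\<lambda>z. (of_real ((x - x0) $ j) + of_real z) ^ i j * R) has_vector_derivative
      of_nat (i j) * (of_real ((x - x0) $ j) ^ (i j - 1) * R)) (at 0)"
      by (rule has_vector_derivative_real_field)
    then show ?thesis by simp
  qed
  ultimately show ?thesis
    by (simp add: has_partial_deriv_def)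
qed

lemma Cn_on_mpow: "open U \<Longrightarrow> Cn_on n U (\<lambda>x. mpow (x - x0) i)"
proof (induction n arbitrary: i)
  case 0
  then show ?case
    by (auto simp: mpow_def intro!: continuous_intros)
next
  case (Suc n)
  have "continuous_on U (\<lambda>x. mpow (x - x0) i :: 'b)"
    using Cn_on_imp_continuous_on[OF Suc.IH[OF Suc.prems]] .
  then show ?case
    using Suc by (intro Cn_on_SucI_on_open[OF _ _ has_partial_deriv_mpow])
      (auto intro: Cn_on_mult Cn_on_const)
qed

lemma taylor_eq_sum_mabs_le:
  fixes f :: "real ^ 'd::finite \<Rightarrow> 'k::real_normed_field"
  shows "taylor n x0 f x =
    (\<Sum>i | mabs i \<le> n. 1 / of_nat (mfact i) * mderiv i f x0 * mpow (x - x0) i)"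
proof -
  have "{i :: 'd \<Rightarrow> nat. mabs i \<le> n} = (\<Union>l\<le>n. {i. mabs i = l})" by auto
  then show ?thesis
    unfolding taylor_def by (simp add: sum.UNION_disjoint finite_mabs_eq disjoint_iff)
qed

lemma Cn_on_taylor: "open U \<Longrightarrow> Cn_on m U (taylor n x0 f)"
  unfolding taylor_eq_sum_mabs_le[abs_def]
  by (intro Cn_on_sum Cn_on_mult Cn_on_mpow Cn_on_const)

lemma mabs_increment: "mabs (i(j := Suc (i j))) = Suc (mabs i)"
proof -
  have "mabs m = m j + (\<Sum>k\<in>UNIV - {j}. m k)" for m :: "'a \<Rightarrow> nat"
    unfolding mabs_def by (rule sum.remove) auto
  note split = this[of i] this[of "i(j := Suc (i j))"]
  have "(\<Sum>k\<in>UNIV - {j}. (i(j := Suc (i j))) k) = (\<Sum>k\<in>UNIV - {j}. i k)"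
    by (rule sum.cong) auto
  with split show ?thesis by simp
qed

lemma mfact_increment: "mfact (i(j := Suc (i j))) = Suc (i j) * mfact i"
proof -
  have "mfact m = fact (m j) * (\<Prod>k\<in>UNIV - {j}. fact (m k))" for m :: "'a \<Rightarrow> nat"
    unfolding mfact_def by (rule prod.remove) auto
  note split = this[of i] this[of "i(j := Suc (i j))"]
  have "(\<Prod>k\<in>UNIV - {j}. fact ((i(j := Suc (i j))) k)) = (\<Prod>k\<in>UNIV - {j}. fact (i k) :: nat)"
    by (rule prod.cong) auto
  with split show ?thesis by (simp add: algebra_simps)
qed

lemma mpow_increment:
  fixes x :: "real ^ 'd::finite"
  shows "mpow x (i(j := Suc (i j))) = (of_real (x $ j) * mpow x i :: 'k::real_normed_field)"
proof -
  have "mpow x m = of_real (x $ j) ^ m j * (\<Prod>k\<in>UNIV - {j}. of_real (x $ k) ^ m k :: 'k)"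
    for m :: "'d \<Rightarrow> nat"
    unfolding mpow_def by (rule prod.remove) auto
  note split = this[of i] this[of "i(j := Suc (i j))"]
  have "(\<Prod>k\<in>UNIV - {j}. of_real (x $ k) ^ (i(j := Suc (i j))) k) =
      (\<Prod>k\<in>UNIV - {j}. of_real (x $ k) ^ i k :: 'k)"
    by (rule prod.cong) auto
  with split show ?thesis by (simp add: mult.assoc)
qed

lemma multi_index_decrementE:
  assumes "i j > 0"
  obtains m where "i = m(j := Suc (m j))"
  using assms by (intro that[of "i(j := i j - 1)"]) auto

text \<open>
  Terms without the variable \<open>j\<close> drop out, and the others correspond to the terms of the Taylor
  polynomial of \<open>\<partial>\<^sub>j f\<close> by lowering the \<open>j\<close>-th exponent: the factor produced by
  differentiation turns \<open>1 / i!\<close> into the reciprocal factorial of the lowered index, and symmetry of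
  mixed derivatives matches the coefficients.
\<close>

lemma has_partial_deriv_taylor:
  fixes f :: "real ^ 'd::finite \<Rightarrow> 'k::real_normed_field"
  assumes "open U" "x0 \<in> U" "Cn_on (Suc n) U f"
  shows "has_partial_deriv j (taylor (Suc n) x0 f) (taylor n x0 (partial_deriv j f) x) x"
proof -
  let ?D = "\<lambda>i. 1 / of_nat (mfact i) * mderiv i f x0 * (of_nat (i j) * mpow (x - x0) (i(j := i j - 1)))"
  have "has_partial_deriv j (taylor (Suc n) x0 f) (\<Sum>i | mabs i \<le> Suc n. ?D i) x"
    unfolding taylor_eq_sum_mabs_le[abs_def]
    using has_partial_deriv_mult[OF has_partial_deriv_const has_partial_deriv_mpow]
    by (intro has_partial_deriv_sum) (simp only: mult_zero_left add_0_left)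
  also have "(\<Sum>i | mabs i \<le> Suc n. ?D i) = (\<Sum>i | mabs i \<le> Suc n \<and> i j > 0. ?D i)"
    by (intro sum.mono_neutral_right finite_mabs_le) auto
  also have "\<dots> = taylor n x0 (partial_deriv j f) x"
    unfolding taylor_eq_sum_mabs_le
  proof (rule sum.reindex_bij_witness[where i = "\<lambda>m. m(j := Suc (m j))" and j = "\<lambda>i. i(j := i j - 1)"])
    fix i assume i: "i \<in> {i. mabs i \<le> Suc n \<and> i j > 0}"
    then obtain m where m: "i = m(j := Suc (m j))" by (blast elim: multi_index_decrementE)
    then have "mabs m \<le> n" using i mabs_increment[of m j] by simp
    then show "i(j := i j - 1) \<in> {i. mabs i \<le> n}" by (simp add: m)
    have "mderiv m (partial_deriv j f) x0 = mderiv i f x0"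
      unfolding m using \<open>mabs m \<le> n\<close> by (intro mderiv_partial_deriv[OF assms(1,3)] assms) auto
    moreover have "i(j := i j - 1) = m" "i j = Suc (m j)" by (simp_all add: m)
    moreover have "1 / of_nat (mfact m) = (of_nat (i j) / of_nat (mfact i) :: 'k)"
    proof -
      have "mfact i = i j * mfact m" "i j \<noteq> 0"
        using mfact_increment[of m j] by (simp_all add: m)
      then show ?thesis by simp
    qed
    ultimately show "1 / of_nat (mfact (i(j := i j - 1))) * mderiv (i(j := i j - 1)) (partial_deriv j f) x0 *
        mpow (x - x0) (i(j := i j - 1)) = ?D i"
      by (simp del: of_nat_Suc)
  qed (auto simp: mabs_increment)
  finally show ?thesis .
qed

lemma taylor_at_center:
  fixes f :: "real ^ 'd::finite \<Rightarrow> 'k::real_normed_field"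
  shows "taylor n x0 f x0 = f x0"
proof -
  have "mpow (0 :: real ^ 'd) i = (if i = (\<lambda>_. 0) then 1 else 0 :: 'k)" for i
    by (auto simp: mpow_def fun_eq_iff)
  then have "taylor n x0 f x0 = 
    (\<Sum>i | mabs i \<le> n. if i = (\<lambda>_. 0) then 1 / of_nat (mfact i) * mderiv i f x0 else 0)"
    unfolding taylor_eq_sum_mabs_le by (intro sum.cong) auto
  also have "\<dots> = 1 / of_nat (mfact (\<lambda>_ :: 'd. 0)) * mderiv (\<lambda>_. 0) f x0"
    by (subst sum.delta[OF finite_mabs_le]) (simp add: mabs_def)
  also have "mderiv (\<lambda>_. 0) f x0 = f x0"
    using length_directions[of "\<lambda>_ :: 'd. 0"] by (simp add: mderiv_eq_partial_derivs mabs_def)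
  finally show ?thesis by (simp add: mfact_def)
qed

lemma mpow_mem_poly_space:
  fixes i :: "'d::finite \<Rightarrow> nat"
  assumes "mabs i \<le> n"
  shows "(\<lambda>x. mpow x i :: 'k::real_normed_field) \<in> poly_space n"
proof -
  have "mpow x i = (\<Sum>m | mabs m \<le> n. (if m = i then 1 else 0) * mpow x m :: 'k)"
    for x :: "real ^ 'd"
    using assms by (simp add: if_distrib[of "\<lambda>c. c * _"] finite_mabs_le cong: if_cong)
  then show ?thesis
    unfolding poly_space_def by (intro CollectI exI[of _ "\<lambda>m. if m = i then 1 else 0"]) auto
qed

lemma poly_space_add:
  assumes "P \<in> poly_space n" "Q \<in> poly_space n"
  shows "(\<lambda>x. P x + Q x) \<in> poly_space n"
proof -
  obtain a b where "P = (\<lambda>x. \<Sum>i | mabs i \<le> n. a i * mpow x i)"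
    "Q = (\<lambda>x. \<Sum>i | mabs i \<le> n. b i * mpow x i)"
    using assms unfolding poly_space_def by blast
  then have "(\<lambda>x. P x + Q x) = (\<lambda>x. \<Sum>i | mabs i \<le> n. (a i + b i) * mpow x i)"
    by (simp add: distrib_right sum.distrib)
  then show ?thesis
    unfolding poly_space_def by (intro CollectI exI[of _ "\<lambda>i. a i + b i"])
qed

lemma poly_space_cmult:
  assumes "P \<in> poly_space n"
  shows "(\<lambda>x. c * P x) \<in> poly_space n"
proof -
  obtain a where "P = (\<lambda>x. \<Sum>i | mabs i \<le> n. a i * mpow x i)"
    using assms unfolding poly_space_def by blast
  then have "(\<lambda>x. c * P x) = (\<lambda>x. \<Sum>i | mabs i \<le> n. (c * a i) * mpow x i)"
    by (simp add: mult.assoc sum_distrib_left)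
  then show ?thesis
    unfolding poly_space_def by (intro CollectI exI[of _ "\<lambda>i. c * a i"])
qed

lemma poly_space_sum:
  assumes "\<And>i. i \<in> I \<Longrightarrow> P i \<in> poly_space n"
  shows "(\<lambda>x. \<Sum>i\<in>I. P i x) \<in> poly_space n"
proof -
  have zero: "(\<lambda>x. 0) \<in> poly_space n"
    unfolding poly_space_def by (auto intro!: exI[of _ "\<lambda>_. 0"])
  show ?thesis
    using assms by (induction I rule: infinite_finite_induct) (auto intro: zero poly_space_add)
qed

lemma poly_space_mono:
  assumes "m \<le> n" "P \<in> poly_space m"
  shows "P \<in> poly_space n"
proof -
  obtain a where "P = (\<lambda>x. \<Sum>i | mabs i \<le> m. a i * mpow x i)"
    using assms unfolding poly_space_def by blast
  then show ?thesis
    using assms(1) by (simp only:) (intro poly_space_sum poly_space_cmult mpow_mem_poly_space, simp)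
qed

lemma poly_space_mult_coordinate:
  assumes "P \<in> poly_space n"
  shows "(\<lambda>x. of_real (x $ j) * P x) \<in> poly_space (Suc n)"
proof -
  obtain a where "P = (\<lambda>x. \<Sum>i | mabs i \<le> n. a i * mpow x i)"
    using assms unfolding poly_space_def by blast
  then have "(\<lambda>x. of_real (x $ j) * P x) = (\<lambda>x. \<Sum>i | mabs i \<le> n. a i * mpow x (i(j := Suc (i j))))"
    by (simp only: sum_distrib_left mpow_increment mult.left_commute)
  also have "\<dots> \<in> poly_space (Suc n)"
    by (intro poly_space_sum poly_space_cmult mpow_mem_poly_space) (simp add: mabs_increment)
  finally show ?thesis .
qed

text \<open>
  A monomial of degree \<open>n + 1\<close> in \<open>x - x0\<close> is one of degree \<open>n\<close> multiplied by an affine factor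
  \<open>x $ j - x0 $ j\<close>, so induction on the degree replaces the multinomial expansion.
\<close>

lemma shifted_mpow_mem_poly_space: "(\<lambda>x. mpow (x - x0) i) \<in> poly_space (mabs i)"
proof (induction "mabs i" arbitrary: i)
  case 0
  then have "(\<lambda>x :: real ^ 'a. mpow (x - x0) i :: 'b) = (\<lambda>x. mpow x i)"
    by (simp add: mabs_def mpow_def)
  then show ?case by (simp add: mpow_mem_poly_space)
next
  case (Suc n)
  then have "mabs i \<noteq> 0" by simp
  then have "\<exists>j. i j > 0" by (auto simp: mabs_def)
  then obtain j m where m: "i = m(j := Suc (m j))" by (blast elim: multi_index_decrementE)
  then have n: "mabs m = n" using Suc(2) mabs_increment[of m j] by simp
  have IH: "(\<lambda>x. mpow (x - x0) m :: 'b) \<in> poly_space n"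
    using Suc(1)[of m] n by simp
  have "(\<lambda>x. mpow (x - x0) i :: 'b) = (\<lambda>x. of_real (x $ j) * mpow (x - x0) m +
      (- of_real (x0 $ j)) * mpow (x - x0) m)"
    by (simp add: m mpow_increment algebra_simps)
  also have "\<dots> \<in> poly_space (Suc n)"
    by (intro poly_space_add poly_space_mult_coordinate poly_space_cmult IH
        poly_space_mono[OF _ IH]) auto
  finally show ?case using Suc(2) by simp
qed

lemma taylor_mem_poly_space: "taylor n x0 f \<in> poly_space n"
  unfolding taylor_eq_sum_mabs_le[abs_def]
  by (intro poly_space_sum poly_space_cmult)
     (auto intro: poly_space_mono shifted_mpow_mem_poly_space)

section \<open>Vanishing to finite order\<close>

text \<open>
  All derivatives of order at most \<open>n\<close>, taken in any order of directions, vanish at \<open>x0\<close>. The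
  recursive form makes this stable under partial derivatives by definition. For
  functions that are \<open>n\<close> times continuously differentiable near \<open>x0\<close> it amounts to the vanishing of
  the Taylor polynomial of order \<open>n\<close>.
\<close>

primrec vanishes_to_order ::
    "nat \<Rightarrow> real ^ 'd::finite \<Rightarrow> (real ^ 'd \<Rightarrow> 'k::real_normed_field) \<Rightarrow> bool"
  where
    "vanishes_to_order 0 x0 f \<longleftrightarrow> f x0 = 0"
  | "vanishes_to_order (Suc n) x0 f \<longleftrightarrow>
      f x0 = 0 \<and> (\<forall>j. vanishes_to_order n x0 (partial_deriv j f))"

lemma vanishes_to_order_imp_zero: "vanishes_to_order n x0 f \<Longrightarrow> f x0 = 0"
  by (cases n) auto

lemma vanishes_to_order_mono: "m \<le> n \<Longrightarrow> vanishes_to_order n x0 f \<Longrightarrow> vanishes_to_order m x0 f"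
proof (induction m arbitrary: n f)
  case 0
  then show ?case by (simp add: vanishes_to_order_imp_zero)
next
  case (Suc m)
  then show ?case by (cases n) auto
qed

lemma vanishes_to_order_cong:
  assumes "open U" "x0 \<in> U" "\<And>x. x \<in> U \<Longrightarrow> f x = g x" "vanishes_to_order n x0 f"
  shows "vanishes_to_order n x0 g"
  using assms(3,4)
proof (induction n arbitrary: f g)
  case 0
  then show ?case using assms(2) by simp
next
  case (Suc n)
  have "vanishes_to_order n x0 (partial_deriv j g)" for j
    by (rule Suc.IH[of "partial_deriv j f"])
       (use Suc.prems partial_deriv_cong_on[OF assms(1) _ Suc.prems(1)] in auto)
  then show ?case using Suc.prems assms(2) by simp
qed

lemma vanishes_to_order_SucI:
  assumes "open U" "x0 \<in> U" "f x0 = 0"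
    and "\<And>j x. x \<in> U \<Longrightarrow> has_partial_deriv j f (f' j x) x"
    and "\<And>j. vanishes_to_order n x0 (f' j)"
  shows "vanishes_to_order (Suc n) x0 f"
proof -
  have "vanishes_to_order n x0 (partial_deriv j f)" for j
    by (rule vanishes_to_order_cong[OF assms(1,2) _ assms(5)[of j]])
       (metis assms(4) has_partial_deriv_imp(2))
  then show ?thesis using assms(3) by simp
qed

lemma vanishes_to_order_zero: "vanishes_to_order n x0 (\<lambda>x. 0)"
proof (induction n)
  case (Suc n)
  then show ?case
    by (intro vanishes_to_order_SucI[of UNIV _ _ "\<lambda>_ _. 0"]) (auto intro: has_partial_deriv_const)
qed simp

lemma vanishes_to_order_add:
  assumes "open U" "x0 \<in> U" "Cn_on n U f" "Cn_on n U g"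
    and "vanishes_to_order n x0 f" "vanishes_to_order n x0 g"
  shows "vanishes_to_order n x0 (\<lambda>x. f x + g x)"
  using assms(3-)
proof (induction n arbitrary: f g)
  case (Suc n)
  show ?case
    by (rule vanishes_to_order_SucI[OF assms(1,2),
          where f' = "\<lambda>j x. partial_deriv j f x + partial_deriv j g x"])
       (use Suc in \<open>auto intro!: has_partial_deriv_add
          intro: partially_differentiable_has_partial_deriv\<close>)
qed simp

text \<open>
  The ideal property. In \<open>\<partial>\<^sub>j (g * f) = \<partial>\<^sub>j g * f + g * \<partial>\<^sub>j f\<close> both \<open>f\<close> and \<open>\<partial>\<^sub>j f\<close> vanish
  to the next lower order, so the induction hypothesis covers each summand; this takes the place of
  the general Leibniz formula for multi-indices.
\<close>

lemma vanishes_to_order_mult: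
  assumes "open U" "x0 \<in> U" "Cn_on n U g" "Cn_on n U f" "vanishes_to_order n x0 f"
  shows "vanishes_to_order n x0 (\<lambda>x. g x * f x)"
  using assms(3-)
proof (induction n arbitrary: f g)
  case (Suc n)
  have "Cn_on n U f" "Cn_on n U g" "vanishes_to_order n x0 f"
    using Suc.prems Cn_on_Suc_imp vanishes_to_order_mono[of n "Suc n"] by (blast, blast, simp)
  then show ?case
    using Suc
    by (intro vanishes_to_order_SucI[OF assms(1,2),
          where f' = "\<lambda>j x. partial_deriv j g x * f x + g x * partial_deriv j f x"])
       (auto intro!: has_partial_deriv_mult vanishes_to_order_add[OF assms(1,2)]
          Cn_on_mult[OF assms(1)] intro: partially_differentiable_has_partial_deriv)
qed simp

lemma vanishes_to_order_sum:
  assumes "open U" "x0 \<in> U"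
    and "\<And>i. i \<in> I \<Longrightarrow> Cn_on n U (f i)" "\<And>i. i \<in> I \<Longrightarrow> vanishes_to_order n x0 (f i)"
  shows "vanishes_to_order n x0 (\<lambda>x. \<Sum>i\<in>I. f i x)"
  using assms(3,4)
  by (induction I rule: infinite_finite_induct)
     (auto intro!: vanishes_to_order_zero vanishes_to_order_add[OF assms(1,2)] Cn_on_sum assms(1))

lemma vanishes_to_order_partial_derivs:
  "vanishes_to_order n x0 f \<Longrightarrow> length js + m \<le> n \<Longrightarrow> vanishes_to_order m x0 (partial_derivs js f)"
proof (induction js arbitrary: m)
  case Nil
  then show ?case using vanishes_to_order_mono by auto
next
  case (Cons j js)
  then have "vanishes_to_order (Suc m) x0 (partial_derivs js f)"
    by (simp del: vanishes_to_order.simps)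
  then show ?case by simp
qed

lemma taylor_eq_zero:
  assumes "vanishes_to_order n x0 f"
  shows "taylor n x0 f = (\<lambda>x. 0)"
proof -
  have "mderiv i f x0 = 0" if "mabs i \<le> n" for i
    using vanishes_to_order_partial_derivs[OF assms, of "directions i" 0] that
    by (simp add: mderiv_eq_partial_derivs length_directions)
  then show ?thesis by (simp add: taylor_eq_sum_mabs_le[abs_def])
qed

text \<open>
  The partial derivatives of the remainder of \<open>f\<close> are the remainders, one order lower, of the partial
  derivatives of \<open>f\<close>.
\<close>

lemma taylor_remainder_vanishes_to_order:
  assumes "open U" "x0 \<in> U" "Cn_on n U f"
  shows "vanishes_to_order n x0 (\<lambda>x. taylor n x0 f x - f x)"
  using assms(3)
proof (induction n arbitrary: f)
  case 0
  then show ?case by (simp add: taylor_at_center)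
next
  case (Suc n)
  show ?case
  proof (rule vanishes_to_order_SucI[OF assms(1,2)])
    show "has_partial_deriv j (\<lambda>x. taylor (Suc n) x0 f x - f x)
        (taylor n x0 (partial_deriv j f) x - partial_deriv j f x) x" if "x \<in> U" for j x
      by (intro has_partial_deriv_diff has_partial_deriv_taylor[OF assms(1,2)]
          Cn_on_has_partial_deriv[OF Suc.prems that] Suc.prems)
    show "vanishes_to_order n x0 (\<lambda>x. taylor n x0 (partial_deriv j f) x - partial_deriv j f x)" for j
      using Suc by auto
  qed (simp add: taylor_at_center)
qed

section \<open>Differential operators\<close>

lemma diff_op_diff:
  assumes "open U" "Cn_on n U f" "Cn_on n U g" "\<gamma> \<le> n" "x \<in> U"
  shows "diff_op \<gamma> c (\<lambda>x. f x - g x) x = diff_op \<gamma> c f x - diff_op \<gamma> c g x"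
proof -
  have "mderiv j (\<lambda>x. f x - g x) x = mderiv j f x - mderiv j g x" if "mabs j \<le> \<gamma>" for j
    unfolding mderiv_eq_partial_derivs
    by (rule partial_derivs_diff[OF assms(1-3) _ assms(5)])
       (use that assms(4) in \<open>simp add: length_directions\<close>)
  then show ?thesis
    by (simp add: diff_op_def sum_subtractf[symmetric] right_diff_distrib)
qed

text \<open>
  A derivative of order at most \<open>\<gamma>\<close> costs at most \<open>\<gamma>\<close> orders of vanishing, and the coefficients
  cost none.
\<close>

lemma diff_op_vanishes_to_order:
  assumes "open U" "x0 \<in> U" "\<gamma> \<le> n"
    and c: "\<And>j. mabs j \<le> \<gamma> \<Longrightarrow> Cn_on (n - \<gamma>) U (c j)"
    and f: "Cn_on n U f" "vanishes_to_order n x0 f"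
  shows "vanishes_to_order (n - \<gamma>) x0 (diff_op \<gamma> c f)"
proof -
  have "Cn_on (n - \<gamma>) U (mderiv j f)" "vanishes_to_order (n - \<gamma>) x0 (mderiv j f)"
    if "mabs j \<le> \<gamma>" for j
    using that assms(3) unfolding mderiv_eq_partial_derivs
    by (auto intro!: Cn_on_partial_derivs[OF f(1)] vanishes_to_order_partial_derivs[OF f(2)]
        simp: length_directions)
  then show ?thesis
    unfolding diff_op_def
    by (intro vanishes_to_order_sum[OF assms(1,2)] vanishes_to_order_mult[OF assms(1,2)]
        Cn_on_sum Cn_on_mult assms(1) c) auto
qed

theorem proposition1:
  fixes x0 :: "real ^ 'd::finite"
    and \<gamma> p :: nat
    and c :: "('d \<Rightarrow> nat) \<Rightarrow> real ^ 'd \<Rightarrow> 'k::real_normed_field"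
    and u :: "real ^ 'd \<Rightarrow> 'k"
  assumes "\<gamma> \<ge> 1"
    and "p \<ge> \<gamma>"
    and "\<And>j. mabs j \<le> \<gamma> \<Longrightarrow> c j \<in> Cn_near (p - \<gamma>) x0"
    and "u \<in> Cn_near (p + \<gamma>) x0"
    and "eventually (\<lambda>x. diff_op \<gamma> c u x = 0) (nhds x0)"
  shows "taylor p x0 u \<in> quasi_Trefftz \<gamma> c x0 p"
proof -
  obtain V where V: "open V" "x0 \<in> V" "Cn_on (p + \<gamma>) V u"
    using assms(4) unfolding Cn_near_def by auto
  obtain E where E: "open E" "x0 \<in> E" "\<And>x. x \<in> E \<Longrightarrow> diff_op \<gamma> c u x = 0"
    using assms(5) unfolding eventually_nhds by blast
  obtain W where W: "\<And>j. mabs j \<le> \<gamma> \<Longrightarrow> open (W j) \<and> x0 \<in> W j \<and> Cn_on (p - \<gamma>) (W j) (c j)"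
    using assms(3) unfolding Cn_near_def mem_Collect_eq by metis
  \<comment> \<open>There are only finitely many coefficients, so one neighborhood serves all hypotheses.\<close>
  define U where "U = V \<inter> E \<inter> (\<Inter>j\<in>{j. mabs j \<le> \<gamma>}. W j)"
  have U: "open U" "x0 \<in> U"
    unfolding U_def using V E W by (auto intro!: open_Int open_INT finite_mabs_le)
  have u: "Cn_on p U u"
    by (rule Cn_on_mono[OF _ Cn_on_subset[OF V(3)]]) (auto simp: U_def)
  have c: "Cn_on (p - \<gamma>) U (c j)" if "mabs j \<le> \<gamma>" for j
    by (rule Cn_on_subset[of _ "W j"]) (use W that in \<open>auto simp: U_def\<close>)
  have T: "Cn_on p U (taylor p x0 u)"
    by (rule Cn_on_taylor[OF U(1)])
  have "vanishes_to_order (p - \<gamma>) x0 (diff_op \<gamma> c (\<lambda>x. taylor p x0 u x - u x))"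
    by (intro diff_op_vanishes_to_order[OF U assms(2) c] Cn_on_diff U T u
        taylor_remainder_vanishes_to_order[OF U u])
  moreover have "diff_op \<gamma> c (\<lambda>x. taylor p x0 u x - u x) x = diff_op \<gamma> c (taylor p x0 u) x"
    if "x \<in> U" for x
    using diff_op_diff[OF U(1) T u assms(2) that, of c] E(3)[of x] that by (simp add: U_def)
  ultimately have "vanishes_to_order (p - \<gamma>) x0 (diff_op \<gamma> c (taylor p x0 u))"
    using vanishes_to_order_cong[OF U] by blast
  then show ?thesis
    using taylor_mem_poly_space by (simp add: quasi_Trefftz_def taylor_eq_zero)
qed

end
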